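(* Let $\beta,\lambda\in\mathbb{C}$. The polynomials $s^{(-)}_m(y)$ defined in the context satisfy, for every integer $m\ge 1$, $$s^{(-)}_m(y)=\big[y+2m(\lambda+m)+\tfrac{\beta}{2}(\lambda-\tfrac{\beta}{2}-1)\big]s^{(-)}_{m-1}(y)-(m-1)(\lambda+m)(\lambda-\tfrac{\beta}{2}+m-1)(\tfrac{\beta}{2}+m)\,s^{(-)}_{m-2}(y),$$ with $s^{(-)}_0(y)=1$ and the convention $s^{(-)}_{-1}(y):=0$.
   Context: For $k\in\mathbb{N}_0$ put $R_k(y;0):=\prod_{l=1}^k\big[y-l(l-1)\big]$ (so $R_0(y;0)=1$). The Pochhammer symbol is $(a)_0=1$, $(a)_m=a(a+1)\cdots(a+m-1)$ for $m\ge 1$. For $m\in\mathbb{N}_0$ define $$s^{(-)}_m(y):=\sum_{k=0}^{m}\binom{m}{k}(\tfrac{\beta}{2}-\lambda-m)_{m-k}(-\tfrac{\beta}{2}-m-1)_{m-k}\,R_k(y;0).$$ *)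

theory Defs
  imports Complex_Main "HOL-Computational_Algebra.Polynomial"
begin

(* The indeterminate y is [:0, 1:], so [:c, 1:] is the polynomial y + c and
   [:c:] is the constant polynomial c. *)

definition R_poly :: "nat \<Rightarrow> complex poly" where
  "R_poly k = (\<Prod>l=1..k. [:0, 1:] - [:of_nat l * (of_nat l - 1):])"

definition s_minus :: "complex \<Rightarrow> complex \<Rightarrow> nat \<Rightarrow> complex poly" where
  "s_minus \<beta> lam m =
     (\<Sum>k=0..m. smult (of_nat (m choose k)
                   * pochhammer (\<beta> / 2 - lam - of_nat m) (m - k)
                   * pochhammer (- \<beta> / 2 - of_nat m - 1) (m - k))
                 (R_poly k))"

(* Integer-indexed version carrying the convention that the polynomial of index -1 is 0;
   the values at the other negative indices are irrelevant. *)
definition s_minus_ext :: "complex \<Rightarrow> complex \<Rightarrow> int \<Rightarrow> complex poly" where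
  "s_minus_ext \<beta> lam m = (if m < 0 then 0 else s_minus \<beta> lam (nat m))"

end

theory Submission
  imports Defs
begin

text \<open>
  Put \<open>a = \<beta>/2 - \<lambda>\<close>, \<open>b = -\<beta>/2 - 1\<close> and \<open>w j = (a - 1 - j) (b - 1 - j)\<close>. Each of the two
  Pochhammer symbols runs through \<open>a - 1 - j\<close>, respectively \<open>b - 1 - j\<close>, for \<open>k \<le> j < m\<close>, so
  the coefficient of \<open>R\<^sub>k\<close> in \<open>s\<^sub>m\<close> is \<open>(m choose k) w k \<cdots> w (m - 1)\<close>. In these terms
  \<open>\<lambda> + m = m - 1 - a - b\<close>, the constant \<open>\<beta>/2 (\<lambda> - \<beta>/2 - 1)\<close> is \<open>(a + 1) (b + 1)\<close>, and the
  factor \<open>(\<lambda> - \<beta>/2 + m - 1) (\<beta>/2 + m)\<close> is \<open>w (m - 2)\<close>.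

  The factors \<open>R\<^sub>k\<close> satisfy \<open>y R\<^sub>k = R\<^bsub>k+1\<^esub> + k (k + 1) R\<^sub>k\<close>, so multiplication by \<open>y\<close> acts on
  coefficients as a shift plus a diagonal term, and the recurrence may be compared coefficientwise
  in the family \<open>R\<^sub>k\<close>. For \<open>k < m\<close> every term at \<open>R\<^sub>k\<close> contains the product \<open>w k \<cdots> w (m - 2)\<close>;
  once it is factored out only binomials and a quadratic polynomial remain, and Pascal's rule
  together with \<open>(m - k) ((m - 1) choose (k - 1)) = k ((m - 1) choose k)\<close> settles the identity
  (lemma \<open>s_coeff_recurrence\<close>).
\<close>

section \<open>The coefficients\<close>

definition weight :: "complex \<Rightarrow> complex \<Rightarrow> nat \<Rightarrow> complex" where
  "weight a b j = (a - 1 - of_nat j) * (b - 1 - of_nat j)"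

definition s_coeff :: "complex \<Rightarrow> complex \<Rightarrow> nat \<Rightarrow> nat \<Rightarrow> complex" where
  "s_coeff a b m k = of_nat (m choose k) * (\<Prod>j=k..<m. weight a b j)"

text \<open>Reversing the order of the factors removes the dependence of each factor on \<open>m\<close>:
  only the range of the product still involves it.\<close>

lemma pochhammer_minus_of_nat_eq_prod:
  fixes x :: "'a :: comm_ring_1"
  assumes "k \<le> m"
  shows "pochhammer (x - of_nat m) (m - k) = (\<Prod>j=k..<m. x - 1 - of_nat j)"
  using assms
proof (induction m rule: dec_induct)
  case (step m)
  have "pochhammer (x - of_nat (Suc m)) (Suc m - k)
      = (x - of_nat (Suc m)) * pochhammer (x - of_nat m) (m - k)"
    using step.hyps by (simp add: Suc_diff_le pochhammer_rec)
  with step show ?case by (simp add: algebra_simps)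
qed simp

lemma s_minus_eq_sum_s_coeff:
  "s_minus \<beta> lam m = (\<Sum>k\<le>m. smult (s_coeff (\<beta> / 2 - lam) (- \<beta> / 2 - 1) m k) (R_poly k))"
proof -
  have "of_nat (m choose k) * pochhammer (\<beta> / 2 - lam - of_nat m) (m - k)
      * pochhammer (- \<beta> / 2 - of_nat m - 1) (m - k)
      = s_coeff (\<beta> / 2 - lam) (- \<beta> / 2 - 1) m k" if "k \<le> m" for k
  proof -
    have "- \<beta> / 2 - of_nat m - 1 = (- \<beta> / 2 - 1) - of_nat m" by simp
    then show ?thesis
      using that
      by (simp only: pochhammer_minus_of_nat_eq_prod s_coeff_def weight_def prod.distrib mult.assoc)
  qed
  then show ?thesis
    unfolding s_minus_def atLeast0AtMost by (intro sum.cong) auto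
qed

lemma s_coeff_eq_0: "m < k \<Longrightarrow> s_coeff a b m k = 0"
  by (simp add: s_coeff_def)

text \<open>This expresses the term of index two lower through the coefficients of index one lower.
  At \<open>n = 0\<close> the truncated \<open>n - 1\<close> is harmless, since both sides vanish.\<close>

lemma s_coeff_absorb:
  "of_nat n * weight a b (n - 1) * s_coeff a b (n - 1) k
     = (of_nat n - of_nat k) * s_coeff a b n k"
proof (cases "k < n")
  case True
  then obtain p where n: "n = Suc p" "k \<le> p" by (cases n) auto
  have "Suc p * (p choose k) = (Suc p - k) * (Suc p choose k)"
    using binomial_absorb_comp[of "Suc p" k] by simp
  then have "of_nat (Suc p) * of_nat (p choose k)
      = (of_nat (Suc p) - of_nat k :: complex) * of_nat (Suc p choose k)"
    using n by (metis of_nat_diff of_nat_mult le_SucI)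
  moreover have "s_coeff a b (Suc p) k
      = of_nat (Suc p choose k) * ((\<Prod>j=k..<p. weight a b j) * weight a b p)"
    using n by (simp add: s_coeff_def)
  moreover have "s_coeff a b p k = of_nat (p choose k) * (\<Prod>j=k..<p. weight a b j)"
    by (simp add: s_coeff_def)
  ultimately show ?thesis
    unfolding n(1) diff_Suc_1 by algebra
next
  case False
  then show ?thesis
    by (cases "k = n"; cases n) (simp_all add: s_coeff_eq_0)
qed

text \<open>After substituting \<open>s_coeff_absorb\<close> both sides are multiples of the same product of
  weights, so the claim is a polynomial identity in \<open>a\<close>, \<open>b\<close>, \<open>n\<close>, \<open>k\<close> modulo the two binomial
  identities. The case distinction supplies the coefficient of index \<open>k - 1\<close>, which is \<open>0\<close> for
  \<open>k = 0\<close>.\<close>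

lemma s_coeff_recurrence:
  "s_coeff a b (Suc n) k =
     (case k of 0 \<Rightarrow> 0 | Suc i \<Rightarrow> s_coeff a b n i)
     + (of_nat k * (of_nat k + 1)
        + 2 * (of_nat n + 1) * (of_nat n - a - b) + (a + 1) * (b + 1)) * s_coeff a b n k
     - of_nat n * (of_nat n - a - b) * weight a b (n - 1) * s_coeff a b (n - 1) k"
proof -
  have lower: "of_nat n * (of_nat n - a - b) * weight a b (n - 1) * s_coeff a b (n - 1) k
      = (of_nat n - a - b) * ((of_nat n - of_nat k) * s_coeff a b n k)"
    using s_coeff_absorb[of n a b k] by (simp add: mult_ac)
  consider "k = 0" | i where "k = Suc i" "i < n" | "k = Suc n" | "k > Suc n"
    by (cases k) force+
  then show ?thesis
  proof cases
    case 1
    then show ?thesis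
      unfolding lower by (simp add: s_coeff_def weight_def algebra_simps)
  next
    case 2
    define P where "P = (\<Prod>j=k..<n. weight a b j)"
    define B where "B = (of_nat (n choose i) :: complex)"
    define B' where "B' = (of_nat (n choose Suc i) :: complex)"
    have "{i..<n} = insert i {k..<n}"
      using 2 by auto
    then have up: "s_coeff a b n i = B * (weight a b i * P)"
      using 2 by (simp add: s_coeff_def B_def P_def)
    have new: "s_coeff a b (Suc n) k = (B + B') * (P * weight a b n)"
      using 2 by (simp add: s_coeff_def B_def B'_def P_def)
    have same: "s_coeff a b n k = B' * P"
      using 2 by (simp add: s_coeff_def B'_def P_def)
    have "Suc i * (n choose Suc i) = (n - i) * (n choose i)"
      using 2 by (metis binomial_absorption binomial_absorb_comp)
    then have "(of_nat i + 1) * B' = (of_nat n - of_nat i) * B"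
      unfolding B_def B'_def using 2
      by (metis add.commute less_imp_le of_nat_Suc of_nat_diff of_nat_mult)
    \<comment> \<open>The second factor comes from \<open>w n - w i = (n - i) (n + i + 2 - a - b)\<close>; this product is
      up to sign the difference of the two sides of the claim.\<close>
    then have "((of_nat i + 1) * B' - (of_nat n - of_nat i) * B)
        * (of_nat n + of_nat i + 2 - a - b) * P = 0"
      by simp
    then show ?thesis
      unfolding lower new same
      unfolding 2(1) nat.case up weight_def of_nat_Suc by algebra
  next
    case 3
    then show ?thesis
      unfolding lower by (simp add: s_coeff_def binomial_eq_0)
  next
    case 4
    then show ?thesis
      unfolding lower by (cases k) (simp_all add: s_coeff_eq_0)
  qed
qed

section \<open>The recurrence for the polynomials\<close>

lemma y_mult_R_poly:
  "[:0, 1:] * R_poly k = R_poly (Suc k) + smult (of_nat k * (of_nat k + 1)) (R_poly k)"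
proof -
  have "R_poly (Suc k) = R_poly k * ([:0, 1:] - [:of_nat (Suc k) * (of_nat (Suc k) - 1):])"
    by (simp add: R_poly_def)
  moreover have "R_poly k * [:of_nat (Suc k) * (of_nat (Suc k) - 1):]
      = smult (of_nat k * (of_nat k + 1)) (R_poly k)"
    by (simp add: algebra_simps)
  ultimately show ?thesis
    by (simp only: right_diff_distrib mult.commute diff_add_cancel)
qed

text \<open>Summing beyond index \<open>m\<close> lets the polynomials of three consecutive indices share one
  range of summation.\<close>

lemma sum_s_coeff_extend:
  assumes "m \<le> N"
  shows "(\<Sum>k\<le>m. smult (s_coeff a b m k) (R_poly k)) = (\<Sum>k\<le>N. smult (s_coeff a b m k) (R_poly k))"
  using assms by (intro sum.mono_neutral_left) (auto simp: s_coeff_eq_0)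

lemma y_mult_sum_s_coeff:
  "[:0, 1:] * (\<Sum>k\<le>n. smult (s_coeff a b n k) (R_poly k)) =
     (\<Sum>k\<le>Suc n. smult ((case k of 0 \<Rightarrow> 0 | Suc i \<Rightarrow> s_coeff a b n i)
                        + of_nat k * (of_nat k + 1) * s_coeff a b n k) (R_poly k))"
proof -
  have "[:0, 1:] * (\<Sum>k\<le>n. smult (s_coeff a b n k) (R_poly k))
      = (\<Sum>k\<le>n. smult (s_coeff a b n k) ([:0, 1:] * R_poly k))"
    by (simp only: sum_distrib_left mult_smult_right)
  also have "\<dots> = (\<Sum>k\<le>n. smult (s_coeff a b n k) (R_poly (Suc k)))
      + (\<Sum>k\<le>n. smult (of_nat k * (of_nat k + 1) * s_coeff a b n k) (R_poly k))"
    by (simp only: y_mult_R_poly smult_add_right sum.distrib smult_smult)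
      (simp only: mult.commute)
  also have "(\<Sum>k\<le>n. smult (s_coeff a b n k) (R_poly (Suc k)))
      = (\<Sum>k\<le>Suc n. smult (case k of 0 \<Rightarrow> 0 | Suc i \<Rightarrow> s_coeff a b n i) (R_poly k))"
    by (simp only: sum.atMost_Suc_shift nat.case smult_0_left add_0)
  also have "(\<Sum>k\<le>n. smult (of_nat k * (of_nat k + 1) * s_coeff a b n k) (R_poly k))
      = (\<Sum>k\<le>Suc n. smult (of_nat k * (of_nat k + 1) * s_coeff a b n k) (R_poly k))"
    by (simp add: s_coeff_eq_0)
  finally show ?thesis
    by (simp only: sum.distrib smult_add_left)
qed

lemma smult_sum_distrib: "smult c (\<Sum>k\<in>A. f k) = (\<Sum>k\<in>A. smult c (f k))"
  by (induction A rule: infinite_finite_induct) (simp_all add: smult_add_right)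

lemma sum_s_coeff_recurrence:
  fixes a b :: complex
  defines "S m \<equiv> (\<Sum>k\<le>m. smult (s_coeff a b m k) (R_poly k))"
  shows "S (Suc n) = [:2 * (of_nat n + 1) * (of_nat n - a - b) + (a + 1) * (b + 1), 1:] * S n
     - smult (of_nat n * (of_nat n - a - b) * weight a b (n - 1)) (S (n - 1))"
proof -
  define c where "c = 2 * (of_nat n + 1) * (of_nat n - a - b) + (a + 1) * (b + 1)"
  define d where "d = of_nat n * (of_nat n - a - b) * weight a b (n - 1)"
  have "[:c, 1:] * S n - smult d (S (n - 1)) = [:0, 1:] * S n + smult c (S n) - smult d (S (n - 1))"
    by simp
  also have "\<dots> = (\<Sum>k\<le>Suc n. smult ((case k of 0 \<Rightarrow> 0 | Suc i \<Rightarrow> s_coeff a b n i)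
        + of_nat k * (of_nat k + 1) * s_coeff a b n k) (R_poly k))
      + smult c (\<Sum>k\<le>Suc n. smult (s_coeff a b n k) (R_poly k))
      - smult d (\<Sum>k\<le>Suc n. smult (s_coeff a b (n - 1) k) (R_poly k))"
    unfolding S_def y_mult_sum_s_coeff
    by (simp only: sum_s_coeff_extend[of n "Suc n"] sum_s_coeff_extend[of "n - 1" "Suc n"]
        le_SucI diff_le_self order_refl)
  also have "\<dots> = (\<Sum>k\<le>Suc n. smult ((case k of 0 \<Rightarrow> 0 | Suc i \<Rightarrow> s_coeff a b n i)
        + of_nat k * (of_nat k + 1) * s_coeff a b n k
        + c * s_coeff a b n k - d * s_coeff a b (n - 1) k) (R_poly k))"
    by (simp only: smult_sum_distrib smult_smult smult_add_left smult_diff_left sum.distrib sum_subtractf)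
  also have "\<dots> = S (Suc n)"
    unfolding S_def
    by (intro sum.cong refl arg_cong2[where f = smult], subst s_coeff_recurrence)
      (simp add: c_def d_def distrib_right add.assoc)
  finally show ?thesis
    by (simp add: c_def d_def)
qed

theorem proposition2p2:
  fixes \<beta> lam :: complex
  shows "s_minus_ext \<beta> lam 0 = 1 \<and>
    (\<forall>m::int. m \<ge> 1 \<longrightarrow>
      s_minus_ext \<beta> lam m =
        [: 2 * of_int m * (lam + of_int m) + \<beta> / 2 * (lam - \<beta> / 2 - 1), 1 :]
          * s_minus_ext \<beta> lam (m - 1)
        - smult ((of_int m - 1) * (lam + of_int m) * (lam - \<beta> / 2 + of_int m - 1)
                  * (\<beta> / 2 + of_int m))
            (s_minus_ext \<beta> lam (m - 2)))"
proof (intro conjI allI impI)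
  show "s_minus_ext \<beta> lam 0 = 1"
    by (simp add: s_minus_ext_def s_minus_def R_poly_def)
next
  fix m :: int
  assume "m \<ge> 1"
  then obtain n where m: "m = int (Suc n)"
    by (intro that[of "nat (m - 1)"]) simp
  let ?a = "\<beta> / 2 - lam" and ?b = "- \<beta> / 2 - 1"
  have diag: "2 * (of_nat n + 1) * (of_nat n - ?a - ?b) + (?a + 1) * (?b + 1)
      = 2 * of_int m * (lam + of_int m) + \<beta> / 2 * (lam - \<beta> / 2 - 1)"
    by (simp add: m field_simps)
  have last: "smult (of_nat n * (of_nat n - ?a - ?b) * weight ?a ?b (n - 1)) (s_minus \<beta> lam (n - 1))
      = smult ((of_int m - 1) * (lam + of_int m) * (lam - \<beta> / 2 + of_int m - 1)
                  * (\<beta> / 2 + of_int m)) (s_minus_ext \<beta> lam (m - 2))"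
  \<comment> \<open>For \<open>n = 0\<close> the truncated index \<open>n - 1\<close> is \<open>0\<close> while \<open>m - 2\<close> is \<open>-1\<close>, but both sides then
    carry the factor \<open>n = m - 1 = 0\<close>.\<close>
  proof (cases n)
    case 0
    then show ?thesis by (simp add: m)
  next
    case (Suc p)
    have "s_minus_ext \<beta> lam (m - 2) = s_minus \<beta> lam p"
      by (simp add: s_minus_ext_def m Suc)
    moreover have "of_nat n * (of_nat n - ?a - ?b) * weight ?a ?b p
        = (of_int m - 1) * (lam + of_int m) * (lam - \<beta> / 2 + of_int m - 1) * (\<beta> / 2 + of_int m)"
      by (simp add: m Suc weight_def field_simps)
    ultimately show ?thesis by (simp add: Suc)
  qed
  have "s_minus \<beta> lam (Suc n)
      = [: 2 * of_int m * (lam + of_int m) + \<beta> / 2 * (lam - \<beta> / 2 - 1), 1 :] * s_minus \<beta> lam n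
        - smult ((of_int m - 1) * (lam + of_int m) * (lam - \<beta> / 2 + of_int m - 1)
                  * (\<beta> / 2 + of_int m)) (s_minus_ext \<beta> lam (m - 2))"
    using sum_s_coeff_recurrence[of ?a ?b n]
    unfolding s_minus_eq_sum_s_coeff[symmetric] diag last .
  moreover have "s_minus_ext \<beta> lam m = s_minus \<beta> lam (Suc n)"
    "s_minus_ext \<beta> lam (m - 1) = s_minus \<beta> lam n"
    by (simp_all add: s_minus_ext_def m nat_add_distrib)
  ultimately show "s_minus_ext \<beta> lam m =
        [: 2 * of_int m * (lam + of_int m) + \<beta> / 2 * (lam - \<beta> / 2 - 1), 1 :]
          * s_minus_ext \<beta> lam (m - 1)
        - smult ((of_int m - 1) * (lam + of_int m) * (lam - \<beta> / 2 + of_int m - 1)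
                  * (\<beta> / 2 + of_int m))
            (s_minus_ext \<beta> lam (m - 2))"
    by simp
qed

end
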